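(* Let $T_1,\dots,T_m\subseteq\{1,\dots,n\}$ with $T_1\cup\dots\cup T_m=\{1,\dots,n\}$. The scaled extremal solutions $y\in\mathbb{R}_+^n$ of the system $$\bigoplus_{i\in T_1}y_i=\bigoplus_{i\in T_2}y_i=\dots=\bigoplus_{i\in T_m}y_i$$ are precisely the vectors $v^K=\bigoplus_{i\in K}e^i$, where $K$ is a nearly minimal covering of the $0$-$1$ matrix $T$ associated with $T_1,\dots,T_m$.
   Context: Here $a\oplus b=\max(a,b)$ on $\mathbb{R}_+=[0,\infty)$, applied componentwise to vectors. $e^i\in\mathbb{R}_+^n$ is the vector with $i$th coordinate $1$ and all others $0$. A vector $y\in\mathbb{R}_+^n$ is scaled if $\bigoplus_{i=1}^ny_i=1$. A solution $x$ of the system is extremal if $x=y\oplus z$ for solutions $y,z$ of the system implies $x=y$ or $x=z$. $T=(t_{ij})$ is the $m\times n$ matrix with $t_{ij}=1$ if $j\in T_i$ and $t_{ij}=0$ otherwise. A subset $K\subseteq\{1,\dots,n\}$ is a covering of $T$ if each $T_i$ contains an index from $K$. A covering is nearly minimal if it contains no more than one proper subset which is also a covering (equivalently, there is at most one $i\in K$ such that $K\setminus\{i\}$ is a covering). *)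

theory Defs
  imports "HOL-Analysis.Analysis"
begin

text \<open>
  The binary operation \<open>x \<oplus> y = max x y\<close>, and its componentwise extension to vectors, is the lattice
  operation \<^const>\<open>sup\<close> on \<^typ>\<open>real\<close> and on \<^typ>\<open>real^'n\<close>; likewise \<open>\<le>\<close> on vectors is componentwise.
  Nonnegativity of a vector is expressed by \<open>0 \<le> x\<close>.
\<close>

text \<open>
  The big max-plus sum \<open>\<Oplus>i\<in>S. f i\<close>. Inserting \<open>0\<close>, the neutral element of \<open>\<oplus>\<close> on nonnegative
  arguments, only affects the empty sum. It is used both for numbers and for vectors.
\<close>
definition bigmax :: "'i set \<Rightarrow> ('i \<Rightarrow> 'a::{lattice, zero}) \<Rightarrow> 'a" where
  "bigmax S f = Sup_fin (insert 0 (f ` S))"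

syntax "_bigmax" :: "pttrn \<Rightarrow> 'i set \<Rightarrow> 'a \<Rightarrow> 'a" ("(3\<Oplus>_\<in>_./ _)" [0, 51, 10] 10)
translations "\<Oplus>i\<in>S. b" == "CONST bigmax S (\<lambda>i. b)"

definition scaled :: "real^'n \<Rightarrow> bool" where
  "scaled y \<longleftrightarrow> 0 \<le> y \<and> (\<Oplus>i\<in>UNIV. y $ i) = 1"

definition solution :: "('m \<Rightarrow> 'n set) \<Rightarrow> real^'n \<Rightarrow> bool" where
  "solution T y \<longleftrightarrow> 0 \<le> y \<and> (\<forall>k l. (\<Oplus>i\<in>T k. y $ i) = (\<Oplus>i\<in>T l. y $ i))"

definition extremal_solution :: "('m \<Rightarrow> 'n::finite set) \<Rightarrow> real^'n \<Rightarrow> bool" where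
  "extremal_solution T x \<longleftrightarrow> solution T x \<and>
     (\<forall>y z. solution T y \<longrightarrow> solution T z \<longrightarrow> x = sup y z \<longrightarrow> x = y \<or> x = z)"

definition incidence_matrix :: "('m::finite \<Rightarrow> 'n::finite set) \<Rightarrow> real^'n^'m" where
  "incidence_matrix T = (\<chi> i j. if j \<in> T i then 1 else 0)"

text \<open>
  Coverings of a 0-1 matrix \<open>A\<close>, whose row \<open>i\<close> represents the set of columns \<open>j\<close> with \<open>A $ i $ j = 1\<close>.
\<close>
definition covering :: "real^'n^'m \<Rightarrow> 'n set \<Rightarrow> bool" where
  "covering A K \<longleftrightarrow> (\<forall>i. \<exists>j\<in>K. A $ i $ j = 1)"

definition nearly_minimal_covering :: "real^'n^'m \<Rightarrow> 'n set \<Rightarrow> bool" where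
  "nearly_minimal_covering A K \<longleftrightarrow> covering A K \<and> (\<exists>\<^sub>\<le>\<^sub>1 L. L \<subset> K \<and> covering A L)"

definition cover_vector :: "'n set \<Rightarrow> real^'n" where
  "cover_vector K = (\<Oplus>i\<in>K. axis i 1)"

lemma covering_incidence_matrix:
  "covering (incidence_matrix T) K \<longleftrightarrow> (\<forall>i. \<exists>j\<in>K. j \<in> T i)"
  by (simp add: covering_def incidence_matrix_def)

lemma sup_vec_component: "sup x y $ i = max (x $ i) (y $ i)" for x y :: "real^'n"
  by (simp add: sup_vec_def sup_max)

lemma bigmax_insert:
  "finite S \<Longrightarrow> bigmax (insert i S) f = sup (f i) (bigmax S f)"
  for f :: "'i \<Rightarrow> 'a::{lattice, zero}"
  by (simp add: bigmax_def insert_commute[of 0])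

lemma bigmax_eq_Max: "S \<noteq> {} \<Longrightarrow> finite S \<Longrightarrow> (\<And>i. i \<in> S \<Longrightarrow> 0 \<le> f i) \<Longrightarrow> bigmax S f = Max (f ` S)"
  for f :: "'i \<Rightarrow> real"
proof -
  assume S: "S \<noteq> {}" "finite S" "\<And>i. i \<in> S \<Longrightarrow> 0 \<le> f i"
  then obtain i where i: "i \<in> S" by blast
  have "0 \<le> f i" "f i \<le> Max (f ` S)" using S i by auto
  then have "Max (insert 0 (f ` S)) = Max (f ` S)" using S by (simp add: max_def)
  moreover have "Sup_fin A = Max A" if "finite A" "A \<noteq> {}" for A :: "real set"
    using that by (induction rule: finite_ne_induct) (auto simp: sup_max)
  ultimately show ?thesis using S by (simp add: bigmax_def)
qed

lemma cover_vector_component: "cover_vector K $ j = (if j \<in> K then 1 else 0)"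
  for K :: "'n::finite set"
proof -
  have "bigmax S (\<lambda>i. axis i 1 :: real^'n) $ j = (if j \<in> S then 1 else 0)" for S :: "'n set" and j
    using finite[of S]
  proof (induction S rule: finite_induct)
    case empty
    then show ?case by (simp add: bigmax_def)
  next
    case (insert i S)
    then show ?case by (auto simp: bigmax_insert sup_vec_component axis_def)
  qed
  then show ?thesis by (simp add: cover_vector_def)
qed

end

theory Submission
  imports Defs
begin

text \<open>
  A scaled solution is a vector with entries in \<open>[0,1]\<close> whose level set \<open>{i. y $ i = 1}\<close> is a
  covering. If some entry \<open>c = y $ j\<close> lies strictly between \<open>0\<close> and \<open>1\<close>, then \<open>y\<close> is the join of \<open>y\<close>
  with entry \<open>j\<close> set to \<open>0\<close> and the truncation of \<open>y\<close> at level \<open>c\<close>, so an extremal \<open>y\<close> is a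
  \<open>cover_vector K\<close>. If \<open>K - {i}\<close> and \<open>K - {j}\<close> are both coverings, \<open>i \<noteq> j\<close>, their vectors join to
  that of \<open>K\<close>. Conversely, the level sets at \<open>1\<close> of two solutions with join \<open>cover_vector K\<close> have
  union \<open>K\<close>, and each of them is empty or a covering.
\<close>

text \<open>As \<open>t\<close> is positive, the inserted \<open>0\<close> respects the bound
  \<open>t\<close> and never attains it, so the maximum is decided by the values on \<open>S\<close>
  alone.\<close>

lemma bigmax_eq_pos_iff:
  fixes f :: "'i \<Rightarrow> real"
  assumes "finite S" "0 < t"
  shows "bigmax S f = t \<longleftrightarrow> (\<forall>i\<in>S. f i \<le> t) \<and> (\<exists>i\<in>S. f i = t)"
proof -
  have "bigmax S f = Max (insert 0 (f ` S))"
  proof -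
    have "Sup_fin A = Max A" if "finite A" "A \<noteq> {}" for A :: "real set"
      using that by (induction rule: finite_ne_induct) (auto simp: sup_max)
    then show ?thesis using assms(1) by (simp add: bigmax_def)
  qed
  then show ?thesis
    using assms by (auto simp: Max_eq_iff)
qed

lemma covering_mono: "covering A K \<Longrightarrow> K \<subseteq> L \<Longrightarrow> covering A L"
  unfolding covering_def by blast

lemma covering_nonempty: "covering A K \<Longrightarrow> K \<noteq> {}"
  unfolding covering_def by blast

text \<open>The sets \<open>T k\<close> exhaust all indices, so the overall maximum is attained
  inside some \<open>T k\<close> and equals the common value. The level \<open>t\<close> is
  arbitrary because a vector truncated below 1 must also be recognised as a solution.\<close>

lemma solution_level_iff:
  fixes T :: "'m::finite \<Rightarrow> 'n::finite set" and y :: "real^'n"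
  assumes T: "(\<Union>k. T k) = UNIV" and t: "0 < t"
  shows "solution T y \<and> (\<Oplus>i\<in>UNIV. y $ i) = t \<longleftrightarrow>
    0 \<le> y \<and> (\<forall>i. y $ i \<le> t) \<and> covering (incidence_matrix T) {i. y $ i = t}"
    (is "?L \<longleftrightarrow> ?R")
proof
  assume L: ?L
  then have le: "\<forall>i. y $ i \<le> t" and "\<exists>i. y $ i = t"
    using t by (simp_all add: bigmax_eq_pos_iff)
  then obtain j where j: "y $ j = t" by blast
  obtain k where "j \<in> T k" using T by blast
  then have "(\<Oplus>i\<in>T k. y $ i) = t" using le j t by (auto simp: bigmax_eq_pos_iff)
  then have "(\<Oplus>i\<in>T l. y $ i) = t" for l
    using L unfolding solution_def by metis
  then have "\<exists>i\<in>T l. y $ i = t" for l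
    using t by (simp add: bigmax_eq_pos_iff)
  then have "covering (incidence_matrix T) {i. y $ i = t}"
    by (auto simp: covering_incidence_matrix)
  then show ?R using L le by (simp add: solution_def)
next
  assume R: ?R
  then have "(\<Oplus>i\<in>T l. y $ i) = t" for l
    using t by (auto simp: bigmax_eq_pos_iff covering_incidence_matrix)
  moreover have "(\<Oplus>i\<in>UNIV. y $ i) = t"
    using R t by (auto simp: bigmax_eq_pos_iff covering_incidence_matrix)
  ultimately show ?L using R by (simp add: solution_def)
qed

lemma scaled_solution_iff:
  fixes T :: "'m::finite \<Rightarrow> 'n::finite set" and y :: "real^'n"
  assumes "(\<Union>k. T k) = UNIV"
  shows "scaled y \<and> solution T y \<longleftrightarrow>
    0 \<le> y \<and> (\<forall>i. y $ i \<le> 1) \<and> covering (incidence_matrix T) {i. y $ i = 1}"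
  using solution_level_iff[OF assms, of 1 y] by (auto simp: scaled_def solution_def)

lemma cover_vector_inject: "cover_vector K = cover_vector L \<longleftrightarrow> K = L"
  for K L :: "'n::finite set"
  by (auto simp: vec_eq_iff cover_vector_component split: if_splits)

lemma cover_vector_Un: "cover_vector (K \<union> L) = sup (cover_vector K) (cover_vector L)"
  for K L :: "'n::finite set"
  by (auto simp: vec_eq_iff cover_vector_component sup_vec_component)

text \<open>Entries outside \<open>K\<close> are squeezed between 0 and 0, so only the entries equal
  to 1 remain to be compared.\<close>

lemma cover_vector_eq_iff:
  fixes y :: "real^'n::finite"
  assumes "0 \<le> y" "y \<le> cover_vector K"
  shows "y = cover_vector K \<longleftrightarrow> {i. y $ i = 1} = K"
proof
  show "{i. y $ i = 1} = K" if "y = cover_vector K"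
    using that by (auto simp: cover_vector_component split: if_splits)
  show "y = cover_vector K" if K: "{i. y $ i = 1} = K"
  proof (unfold vec_eq_iff, rule allI)
    fix i
    have "0 \<le> y $ i" "y $ i \<le> cover_vector K $ i"
      using assms by (simp_all add: less_eq_vec_def)
    then show "y $ i = cover_vector K $ i"
      using K by (auto simp: cover_vector_component split: if_splits)
  qed
qed

lemma scaled_solution_cover_vector_iff:
  fixes T :: "'m::finite \<Rightarrow> 'n::finite set"
  assumes "(\<Union>k. T k) = UNIV"
  shows "scaled (cover_vector K) \<and> solution T (cover_vector K) \<longleftrightarrow>
    covering (incidence_matrix T) K"
proof -
  have "{i. cover_vector K $ i = 1} = K"
    by (auto simp: cover_vector_component split: if_splits)
  then show ?thesis
    by (simp add: scaled_solution_iff[OF assms] less_eq_vec_def cover_vector_component)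
qed

lemma scaled_extremal_solution_zero_one:
  fixes T :: "'m::finite \<Rightarrow> 'n::finite set"
  assumes T: "(\<Union>k. T k) = UNIV" and "scaled y" and ext: "extremal_solution T y"
  shows "y $ j = 0 \<or> y $ j = 1"
proof (rule ccontr)
  assume j: "\<not> ?thesis"
  have y: "0 \<le> y" "\<And>i. y $ i \<le> 1" and cov: "covering (incidence_matrix T) {i. y $ i = 1}"
    using scaled_solution_iff[OF T, of y] assms by (auto simp: extremal_solution_def)
  have y0: "0 \<le> y $ i" for i using y(1) by (simp add: less_eq_vec_def)
  define c where "c = y $ j"
  have c: "0 < c" "c < 1"
    using j y0[of j] y(2)[of j] unfolding c_def by linarith+
  define u :: "real^'n" where "u = (\<chi> i. if i = j then 0 else y $ i)"
  define w :: "real^'n" where "w = (\<chi> i. min (y $ i) c)"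
  \<comment> \<open>Since \<open>c < 1\<close>, zeroing entry \<open>j\<close> loses no index of the
    level set at 1.\<close>
  have "covering (incidence_matrix T) {i. u $ i = 1}"
    using cov by (rule covering_mono) (use c in \<open>auto simp: u_def c_def\<close>)
  then have u: "solution T u"
    using scaled_solution_iff[OF T, of u] y(2) y0 by (auto simp: u_def less_eq_vec_def)
  \<comment> \<open>Every entry equal to 1 is cut down to \<open>c\<close>, so the level set of
    \<open>w\<close> at \<open>c\<close> contains that of \<open>y\<close> at 1.\<close>
  have "covering (incidence_matrix T) {i. w $ i = c}"
    using cov by (rule covering_mono) (use c in \<open>auto simp: w_def\<close>)
  then have w: "solution T w"
    using solution_level_iff[OF T c(1), of w] y0 c by (auto simp: w_def less_eq_vec_def)
  \<comment> \<open>At \<open>j\<close> the value \<open>c\<close> comes from \<open>w\<close>;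
    elsewhere \<open>u\<close> agrees with \<open>y\<close> and \<open>w\<close> lies below
    it.\<close>
  have "y = sup u w"
    using y0 by (auto simp: vec_eq_iff sup_vec_component u_def w_def c_def)
  then have "y = u \<or> y = w"
    using ext u w unfolding extremal_solution_def by blast
  moreover have "y \<noteq> u" using c by (auto simp: vec_eq_iff u_def c_def)
  moreover obtain i where "y $ i = 1" using covering_nonempty[OF cov] by blast
  then have "y $ i \<noteq> w $ i" using c by (simp add: w_def)
  ultimately show False by auto
qed

lemma nearly_minimal_if_extremal:
  fixes T :: "'m::finite \<Rightarrow> 'n::finite set"
  assumes T: "(\<Union>k. T k) = UNIV"
    and K: "covering (incidence_matrix T) K"
    and ext: "extremal_solution T (cover_vector K)"
  shows "nearly_minimal_covering (incidence_matrix T) K"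
proof -
  \<comment> \<open>The claim is symmetric in \<open>L\<close> and \<open>M\<close>, so inclusion
    for all such pairs already yields equality.\<close>
  have diff: "L \<subseteq> M" if L: "L \<subset> K" "covering (incidence_matrix T) L"
      and M: "M \<subset> K" "covering (incidence_matrix T) M" for L M
  proof
    fix i assume i: "i \<in> L"
    show "i \<in> M"
    proof (rule ccontr)
      assume "i \<notin> M"
      obtain j where j: "j \<in> K" "j \<notin> L" using L by blast
      \<comment> \<open>These sets contain \<open>M\<close> and \<open>L\<close> respectively, and
        \<open>i \<noteq> j\<close> because \<open>i\<close> is in \<open>L\<close> and
        \<open>j\<close> is not.\<close>
      have "covering (incidence_matrix T) (K - {i})" "covering (incidence_matrix T) (K - {j})"
        using covering_mono[OF M(2), of "K - {i}"] covering_mono[OF L(2), of "K - {j}"]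
          L M j \<open>i \<notin> M\<close> by blast+
      then have "solution T (cover_vector (K - {i}))" "solution T (cover_vector (K - {j}))"
        using scaled_solution_cover_vector_iff[OF T] by blast+
      moreover have "K = (K - {i}) \<union> (K - {j})" using i j by blast
      then have "cover_vector K = sup (cover_vector (K - {i})) (cover_vector (K - {j}))"
        by (metis cover_vector_Un)
      ultimately have "K = K - {i} \<or> K = K - {j}"
        using ext unfolding extremal_solution_def by (metis cover_vector_inject)
      then show False using i j L by blast
    qed
  qed
  show ?thesis
    unfolding nearly_minimal_covering_def Uniq_def using K diff by (meson subset_antisym)
qed

lemma extremal_if_nearly_minimal:
  fixes T :: "'m::finite \<Rightarrow> 'n::finite set"
  assumes T: "(\<Union>k. T k) = UNIV"
    and K: "nearly_minimal_covering (incidence_matrix T) K"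
  shows "extremal_solution T (cover_vector K)"
proof -
  have "covering (incidence_matrix T) K"
    using K by (simp add: nearly_minimal_covering_def)
  then have sol: "solution T (cover_vector K)"
    using scaled_solution_cover_vector_iff[OF T] by blast
  have le1: "x $ i \<le> 1" if "x \<le> cover_vector K" for x :: "real^'n" and i
  proof -
    have "x $ i \<le> cover_vector K $ i" using that by (simp add: less_eq_vec_def)
    then show ?thesis by (simp add: cover_vector_component split: if_splits)
  qed
  \<comment> \<open>A single entry equal to 1 makes the overall maximum 1, which brings in the level
    characterisation.\<close>
  have level: "{i. x $ i = 1} = {} \<or> covering (incidence_matrix T) {i. x $ i = 1}"
    if "solution T x" "x \<le> cover_vector K" for x
  proof (cases "{i. x $ i = 1} = {}")
    case False
    then have "(\<Oplus>i\<in>UNIV. x $ i) = 1"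
      using le1[OF that(2)] by (auto simp: bigmax_eq_pos_iff)
    then show ?thesis
      using solution_level_iff[OF T, of 1 x] that(1) by simp
  qed simp
  have "cover_vector K = y \<or> cover_vector K = z"
    if yz: "solution T y" "solution T z" "cover_vector K = sup y z" for y z
  proof -
    let ?Y = "{i. y $ i = 1}" and ?Z = "{i. z $ i = 1}"
    have le: "y \<le> cover_vector K" "z \<le> cover_vector K" by (simp_all add: yz(3))
    have "i \<in> K \<longleftrightarrow> y $ i = 1 \<or> z $ i = 1" for i
    proof -
      have "i \<in> K \<longleftrightarrow> max (y $ i) (z $ i) = 1"
        unfolding sup_vec_component[symmetric] yz(3)[symmetric]
        by (simp add: cover_vector_component)
      then show ?thesis
        using le1[OF le(1), of i] le1[OF le(2), of i] by linarith
    qed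
    then have un: "K = ?Y \<union> ?Z" by auto
    have "?Y = K \<or> ?Z = K"
    proof (rule ccontr)
      assume neq: "\<not> ?thesis"
      then have "?Y \<subset> K" "?Z \<subset> K" using un by auto
      \<comment> \<open>Neither level set is empty, since otherwise the other would be all of
        \<open>K\<close>.\<close>
      moreover have "covering (incidence_matrix T) ?Y" "covering (incidence_matrix T) ?Z"
        using level[OF yz(1) le(1)] level[OF yz(2) le(2)] un neq by auto
      ultimately have "?Y = ?Z"
        using K unfolding nearly_minimal_covering_def Uniq_def by blast
      \<comment> \<open>Equal level sets would each coincide with their union
        \<open>K\<close>.\<close>
      then show False using un neq by auto
    qed
    moreover have "0 \<le> y" "0 \<le> z" using yz by (simp_all add: solution_def)
    ultimately show ?thesis
      using cover_vector_eq_iff[of y K] cover_vector_eq_iff[of z K] le by auto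
  qed
  then show ?thesis using sol unfolding extremal_solution_def by blast
qed

theorem proposition6p6:
  fixes T :: "'m::finite \<Rightarrow> 'n::finite set"
  assumes "(\<Union>k. T k) = UNIV"
  shows "{y. scaled y \<and> extremal_solution T y}
       = {cover_vector K | K. nearly_minimal_covering (incidence_matrix T) K}"
proof (intro equalityI subsetI)
  fix y assume "y \<in> {y. scaled y \<and> extremal_solution T y}"
  then have y: "scaled y" "extremal_solution T y" by auto
  define K where "K = {i. y $ i = 1}"
  \<comment> \<open>All entries are 0 or 1, so those outside the level set at 1 vanish.\<close>
  have "y = cover_vector K"
    using scaled_extremal_solution_zero_one[OF assms y]
    by (auto simp: vec_eq_iff cover_vector_component K_def)
  moreover have "covering (incidence_matrix T) K"
    using scaled_solution_iff[OF assms, of y] y by (simp add: K_def extremal_solution_def)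
  ultimately show "y \<in> {cover_vector K | K. nearly_minimal_covering (incidence_matrix T) K}"
    using nearly_minimal_if_extremal[OF assms] y(2) by blast
next
  fix y :: "real^'n"
  assume "y \<in> {cover_vector K | K. nearly_minimal_covering (incidence_matrix T) K}"
  then obtain K where K: "nearly_minimal_covering (incidence_matrix T) K" "y = cover_vector K"
    by blast
  then have "scaled y"
    using scaled_solution_cover_vector_iff[OF assms, of K]
    by (simp add: nearly_minimal_covering_def)
  then show "y \<in> {y. scaled y \<and> extremal_solution T y}"
    using extremal_if_nearly_minimal[OF assms] K by simp
qed

end
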